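(* Let $\Gamma$ be a connected graph without loops or multiple edges. Then $\Gamma$ is the line graph $L(\Delta)$ of some multi-graph $\Delta$ if and only if $\Gamma$ contains no induced subgraph isomorphic to a member of the class $\mathcal{E}_6$.
   Context: A multi-graph is a graph without loops in which multiple edges between two vertices are allowed (it may be infinite). The line graph $L(\Delta)$ of a multi-graph $\Delta$ is the ordinary graph whose vertices are the edges of $\Delta$, two edges being adjacent if and only if they meet in exactly one vertex of $\Delta$ (so parallel edges are non-adjacent). Let $(V,Q)$ be a $6$-dimensional vector space over $\mathbb{F}_2$ with a nondegenerate quadratic form $Q$ of $-$-type (Arf invariant $1$, i.e. Witt index $2$). A vector $v$ is anisotropic if $Q(v)=1$. For a basis $B$ of $V$ consisting of anisotropic vectors, consider the graph with vertex set $B$ in which distinct $v,w\in B$ are adjacent iff $Q(v+w)=1$. The class $\mathcal{E}_6$ consists of all connected graphs (up to isomorphism) arising in this way; it contains the Dynkin graph $E_6$ (the tree obtained from a path $x_1x_2x_3x_4x_5$ by adding a vertex $x_6$ adjacent to $x_3$), and consists of $33$ graphs on $6$ vertices. *)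

theory Defs
  imports "HOL-Analysis.Analysis" "HOL-Library.Z2"
begin

section \<open>Simple graphs\<close>

text \<open>Graphs may be infinite. Adjacency is a relation, required by \<open>simple_graph\<close> to be
  symmetric and irreflexive on the vertex set.\<close>

record 'a sgraph =
  verts :: "'a set"
  adj :: "('a \<times> 'a) set"

definition simple_graph :: "'a sgraph \<Rightarrow> bool" where
  "simple_graph G \<longleftrightarrow> adj G \<subseteq> verts G \<times> verts G \<and> sym (adj G) \<and> irrefl (adj G)"

definition connected_graph :: "'a sgraph \<Rightarrow> bool" where
  "connected_graph G \<longleftrightarrow> (\<forall>u\<in>verts G. \<forall>v\<in>verts G. (u, v) \<in> (adj G)\<^sup>*)"

definition graph_iso :: "'a sgraph \<Rightarrow> 'b sgraph \<Rightarrow> bool" where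
  "graph_iso G H \<longleftrightarrow> (\<exists>f. bij_betw f (verts G) (verts H) \<and>
     (\<forall>u\<in>verts G. \<forall>v\<in>verts G. (u, v) \<in> adj G \<longleftrightarrow> (f u, f v) \<in> adj H))"

definition induced_subgraph :: "'a sgraph \<Rightarrow> 'a set \<Rightarrow> 'a sgraph" where
  "induced_subgraph G W = \<lparr>verts = W, adj = adj G \<inter> (W \<times> W)\<rparr>"

section \<open>Multi-graphs and their line graphs\<close>

text \<open>Edges are abstract objects carrying their set of two distinct ends, so parallel edges are
  allowed and loops are not.\<close>

record ('v, 'e) multigraph =
  mverts :: "'v set"
  medges :: "'e set"
  ends :: "'e \<Rightarrow> 'v set"

definition multi_graph :: "('v, 'e) multigraph \<Rightarrow> bool" where
  "multi_graph D \<longleftrightarrow> (\<forall>e\<in>medges D. ends D e \<subseteq> mverts D \<and> card (ends D e) = 2)"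

definition line_graph :: "('v, 'e) multigraph \<Rightarrow> 'e sgraph" where
  "line_graph D = \<lparr>verts = medges D,
     adj = {(e, f). e \<in> medges D \<and> f \<in> medges D \<and> card (ends D e \<inter> ends D f) = 1}\<rparr>"

text \<open>HOL does not allow quantification over the vertex and edge types of the multi-graph. Edges
  of type \<open>'a\<close> and vertices of type \<open>'a \<times> bool\<close> suffice, since isolated vertices do not influence
  the line graph and every edge has two ends; \<open>is_line_graph_of_multigraphI\<close> below shows that
  multi-graphs over arbitrary types give nothing more.\<close>

definition is_line_graph_of_multigraph :: "'a sgraph \<Rightarrow> bool" where
  "is_line_graph_of_multigraph G \<longleftrightarrow>
     (\<exists>D :: ('a \<times> bool, 'a) multigraph. multi_graph D \<and> graph_iso G (line_graph D))"

lemma is_line_graph_of_multigraphI: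
  fixes G :: "'a sgraph" and D :: "('v, 'e) multigraph"
  assumes D: "multi_graph D" and iso: "graph_iso G (line_graph D)"
  shows "is_line_graph_of_multigraph G"
proof -
  obtain f where f: "bij_betw f (verts G) (medges D)"
    and fadj: "\<forall>u\<in>verts G. \<forall>v\<in>verts G. (u, v) \<in> adj G \<longleftrightarrow> (f u, f v) \<in> adj (line_graph D)"
    using iso by (auto simp: graph_iso_def line_graph_def)
  have fE: "f a \<in> medges D" if "a \<in> verts G" for a
    using f that by (auto simp: bij_betw_def)
  have "\<forall>a\<in>verts G. \<exists>x y. ends D (f a) = {x, y}"
    using D fE by (metis multi_graph_def card_2_iff)
  then obtain s t where st: "\<And>a. a \<in> verts G \<Longrightarrow> ends D (f a) = {s a, t a}"
    by metis
  define h where "h = (\<lambda>(a, b). if b then s a else t a)"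
  define X where "X = h ` (verts G \<times> UNIV)"
  define g where "g = inv_into (verts G \<times> UNIV) h"
  have inj: "inj_on g X"
    unfolding g_def X_def by (rule inj_on_inv_into) simp
  have gX: "g ` X \<subseteq> verts G \<times> UNIV"
    unfolding g_def X_def by (metis image_subsetI inv_into_into)
  have endsX: "ends D (f a) \<subseteq> X" if "a \<in> verts G" for a
  proof -
    have "h (a, True) \<in> X" "h (a, False) \<in> X"
      using that unfolding X_def by blast+
    then show ?thesis
      using st[OF that] by (simp add: h_def)
  qed
  define D' where "D' = \<lparr>mverts = verts G \<times> (UNIV :: bool set), medges = verts G,
    ends = (\<lambda>a. g ` ends D (f a))\<rparr>"
  have "multi_graph D'"
    unfolding multi_graph_def
  proof
    fix a assume "a \<in> medges D'"
    then have a: "a \<in> verts G" by (simp add: D'_def)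
    have "card (g ` ends D (f a)) = card (ends D (f a))"
      using inj endsX[OF a] by (meson card_image inj_on_subset)
    moreover have "card (ends D (f a)) = 2"
      using D fE[OF a] by (simp add: multi_graph_def)
    moreover have "g ` ends D (f a) \<subseteq> verts G \<times> UNIV"
      using endsX[OF a] gX by blast
    ultimately show "ends D' a \<subseteq> mverts D' \<and> card (ends D' a) = 2"
      by (simp add: D'_def)
  qed
  moreover have "graph_iso G (line_graph D')"
    unfolding graph_iso_def
  proof (intro exI[of _ id] conjI ballI)
    show "bij_betw id (verts G) (verts (line_graph D'))"
      by (simp add: line_graph_def D'_def)
  next
    fix u v assume u: "u \<in> verts G" and v: "v \<in> verts G"
    have "g ` ends D (f u) \<inter> g ` ends D (f v) = g ` (ends D (f u) \<inter> ends D (f v))"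
      using inj_on_image_Int[OF inj endsX[OF u] endsX[OF v]] by simp
    moreover have "card (g ` (ends D (f u) \<inter> ends D (f v))) = card (ends D (f u) \<inter> ends D (f v))"
      using inj endsX[OF u] by (meson card_image inf.coboundedI1 inj_on_subset)
    ultimately show "(u, v) \<in> adj G \<longleftrightarrow> (id u, id v) \<in> adj (line_graph D')"
      using u v fadj fE by (simp add: line_graph_def D'_def)
  qed
  ultimately show ?thesis
    unfolding is_line_graph_of_multigraph_def by blast
qed

section \<open>Quadratic forms\<close>

definition polar :: "('a::field ^ 'n \<Rightarrow> 'a) \<Rightarrow> 'a ^ 'n \<Rightarrow> 'a ^ 'n \<Rightarrow> 'a" where
  "polar Q v w = Q (v + w) - Q v - Q w"

definition quadratic_form :: "('a::field ^ 'n \<Rightarrow> 'a) \<Rightarrow> bool" where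
  "quadratic_form Q \<longleftrightarrow> (\<forall>c v. Q (c *s v) = c\<^sup>2 * Q v) \<and>
     (\<forall>v. Vector_Spaces.linear (*s) (*) (\<lambda>w. polar Q v w)) \<and>
     (\<forall>w. Vector_Spaces.linear (*s) (*) (\<lambda>v. polar Q v w))"

definition nondegenerate :: "('a::field ^ 'n \<Rightarrow> 'a) \<Rightarrow> bool" where
  "nondegenerate Q \<longleftrightarrow> (\<forall>v. (\<forall>w. polar Q v w = 0) \<longrightarrow> v = 0)"

definition totally_singular :: "('a::field ^ 'n \<Rightarrow> 'a) \<Rightarrow> ('a ^ 'n) set \<Rightarrow> bool" where
  "totally_singular Q U \<longleftrightarrow> vec.subspace U \<and> (\<forall>u\<in>U. Q u = 0)"

definition witt_index :: "('a::field ^ 'n \<Rightarrow> 'a) \<Rightarrow> nat" where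
  "witt_index Q = Max {vec.dim U | U. totally_singular Q U}"

section \<open>The class of graphs from anisotropic bases in the minus-type space of dimension 6\<close>

definition basis_graph :: "(bit ^ 'n \<Rightarrow> bit) \<Rightarrow> (bit ^ 'n) set \<Rightarrow> (bit ^ 'n) sgraph" where
  "basis_graph Q B = \<lparr>verts = B, adj = {(v, w). v \<in> B \<and> w \<in> B \<and> v \<noteq> w \<and> Q (v + w) = 1}\<rparr>"

text \<open>Every 6-dimensional space over the field with two elements is isomorphic to \<open>bit ^ 6\<close>.
  The minus-type forms on it are the nondegenerate quadratic forms of Witt index 2; they are all
  isometric, so ranging over all of them or fixing one yields the same class up to
  isomorphism.\<close>

definition class_E6 :: "(bit ^ 6) sgraph set" where
  "class_E6 = {basis_graph Q B | (Q :: bit ^ 6 \<Rightarrow> bit) B.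
     quadratic_form Q \<and> nondegenerate Q \<and> witt_index Q = 2 \<and>
     vec.independent B \<and> vec.span B = UNIV \<and> (\<forall>v\<in>B. Q v = 1) \<and>
     connected_graph (basis_graph Q B)}"

end

theory Submission
  imports Defs
begin

text \<open>Six edges of a multi-graph whose adjacency matrix is nonsingular and which form a connected
  graph are the edges of a tree on seven points. They span the even weight vectors of
  \<open>F\<^sub>2\<^sup>7\<close>, where the quadratic form is half the weight; the simplex code is a totally singular
  3-space, so the form does not have minus type.

  Conversely, parallel edges reduce the claim to graphs in which no two vertices have the same
  neighbours. In such a graph a claw together with two vertices separating its leaves always lies
  in \<open>E\<^sub>6\<close>, and so does a diamond whose two triangles are both odd together with two vertices
  witnessing this (a triangle is odd if some vertex is adjacent to an odd number of its vertices).
  Hence the conditions of van Rooij and Wilf hold: an edge together with its odd triangles spans a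
  clique, these cliques partition the edges, and every vertex lies on at most two of them. The
  cliques are the points of the multi-graph.\<close>

subsection \<open>Coordinates in dimensions 6 and 7\<close>

lemma exhaust_6:
  fixes x :: 6
  shows "x = 1 \<or> x = 2 \<or> x = 3 \<or> x = 4 \<or> x = 5 \<or> x = 6"
proof (induct x)
  case (of_int z)
  then have "z = 0 \<or> z = 1 \<or> z = 2 \<or> z = 3 \<or> z = 4 \<or> z = 5" by fastforce
  then show ?case by auto
qed

lemma exhaust_7:
  fixes x :: 7
  shows "x = 1 \<or> x = 2 \<or> x = 3 \<or> x = 4 \<or> x = 5 \<or> x = 6 \<or> x = 7"
proof (induct x)
  case (of_int z)
  then have "z = 0 \<or> z = 1 \<or> z = 2 \<or> z = 3 \<or> z = 4 \<or> z = 5 \<or> z = 6" by fastforce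
  then show ?case by auto
qed

lemma forall_6: "(\<forall>i::6. P i) \<longleftrightarrow> P 1 \<and> P 2 \<and> P 3 \<and> P 4 \<and> P 5 \<and> P 6"
  by (metis exhaust_6)

lemma forall_7: "(\<forall>i::7. P i) \<longleftrightarrow> P 1 \<and> P 2 \<and> P 3 \<and> P 4 \<and> P 5 \<and> P 6 \<and> P 7"
  by (metis exhaust_7)

lemma UNIV_7: "UNIV = {1, 2, 3, 4, 5, 6, 7::7}"
  using exhaust_7 by auto

lemma sum_7: "sum f (UNIV::7 set) = f 1 + f 2 + f 3 + f 4 + f 5 + f 6 + f 7"
  unfolding UNIV_7 by (simp add: ac_simps)

lemma vector_6:
  "(vector [a, b, c, d, e, f] :: 'a::zero ^ 6) $ 1 = a"
  "(vector [a, b, c, d, e, f] :: 'a::zero ^ 6) $ 2 = b"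
  "(vector [a, b, c, d, e, f] :: 'a::zero ^ 6) $ 3 = c"
  "(vector [a, b, c, d, e, f] :: 'a::zero ^ 6) $ 4 = d"
  "(vector [a, b, c, d, e, f] :: 'a::zero ^ 6) $ 5 = e"
  "(vector [a, b, c, d, e, f] :: 'a::zero ^ 6) $ 6 = f"
  unfolding vector_def by auto

lemma vector_7:
  "(vector [a, b, c, d, e, f, g] :: 'a::zero ^ 7) $ 1 = a"
  "(vector [a, b, c, d, e, f, g] :: 'a::zero ^ 7) $ 2 = b"
  "(vector [a, b, c, d, e, f, g] :: 'a::zero ^ 7) $ 3 = c"
  "(vector [a, b, c, d, e, f, g] :: 'a::zero ^ 7) $ 4 = d"
  "(vector [a, b, c, d, e, f, g] :: 'a::zero ^ 7) $ 5 = e"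
  "(vector [a, b, c, d, e, f, g] :: 'a::zero ^ 7) $ 6 = f"
  "(vector [a, b, c, d, e, f, g] :: 'a::zero ^ 7) $ 7 = g"
  unfolding vector_def by auto

subsection \<open>Quadratic forms and the Witt index\<close>

lemma linear_vec_iff:
  "Vector_Spaces.linear (*s) (*s) (f :: 'a::field ^ 'n \<Rightarrow> 'a ^ 'm) \<longleftrightarrow>
     (\<forall>x y. f (x + y) = f x + f y) \<and> (\<forall>c x. f (c *s x) = c *s f x)"
  by (simp add: Vector_Spaces.linear_iff vec.vector_space_axioms)

lemma linear_functional_iff:
  "Vector_Spaces.linear (*s) (*) (f :: 'a::field ^ 'n \<Rightarrow> 'a) \<longleftrightarrow>
     (\<forall>x y. f (x + y) = f x + f y) \<and> (\<forall>c x. f (c *s x) = c * f x)"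
  by (simp add: Vector_Spaces.linear_iff vec.vector_space_axioms
      vector_space_over_itself.vector_space_axioms)

lemma witt_index_ge:
  fixes Q :: "'a::field ^ 'n \<Rightarrow> 'a"
  assumes "totally_singular Q U"
  shows "vec.dim U \<le> witt_index Q"
proof -
  have "{vec.dim U | U. totally_singular Q U} \<subseteq> {..vec.dim (UNIV :: ('a ^ 'n) set)}"
    using vec.dim_subset by blast
  then have "finite {vec.dim U | U. totally_singular Q U}"
    using finite_subset by blast
  then show ?thesis
    unfolding witt_index_def using assms by (intro Max_ge) auto
qed

lemma witt_index_le:
  fixes Q :: "'a::field ^ 'n \<Rightarrow> 'a"
  assumes "Q 0 = 0" and le: "\<And>U. totally_singular Q U \<Longrightarrow> vec.dim U \<le> n"
  shows "witt_index Q \<le> n"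
proof -
  have "{vec.dim U | U. totally_singular Q U} \<subseteq> {..n}"
    using le by blast
  then have "finite {vec.dim U | U. totally_singular Q U}"
    using finite_subset by blast
  moreover have "totally_singular Q {0}"
    using assms(1) by (simp add: totally_singular_def)
  ultimately show ?thesis
    unfolding witt_index_def using le by (subst Max_le_iff) auto
qed

lemma witt_index_ge_inj:
  fixes Q :: "'a::field ^ 'n \<Rightarrow> 'a" and f :: "'a ^ 'm \<Rightarrow> 'a ^ 'n"
  assumes f: "Vector_Spaces.linear (*s) (*s) f" "inj f" and "\<And>x. Q (f x) = 0"
  shows "CARD('m) \<le> witt_index Q"
proof -
  have "vec.subspace (range f)"
    by (simp add: f(1) vec.linear_subspace_image)
  then have "totally_singular Q (range f)"
    using assms(3) by (auto simp: totally_singular_def)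
  moreover have "vec.dim (range f) = CARD('m)"
    using vec.dim_image_eq[OF f(1), of UNIV] f(2) unfolding vec.span_UNIV vec_dim_card by blast
  ultimately show ?thesis
    using witt_index_ge by metis
qed

lemma polar_self: "polar Q v v = 0" if "quadratic_form Q" for Q :: "bit ^ 'n \<Rightarrow> bit"
proof -
  have "Q (0 *s v) = 0\<^sup>2 * Q v"
    using that unfolding quadratic_form_def by blast
  moreover have "v + v = 0"
    by (simp add: vec_eq_iff)
  ultimately show ?thesis
    by (simp add: polar_def)
qed

lemma polar_commute: "polar Q v w = polar Q w v"
  by (simp add: polar_def add.commute)

subsection \<open>A form of minus type\<close>

text \<open>Orthogonal sum of the anisotropic plane on coordinates 1, 2 and the hyperbolic planes on
  coordinates 3, 5 and 4, 6.\<close>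

definition minus_form :: "bit ^ 6 \<Rightarrow> bit" where
  "minus_form x = x $ 1 * x $ 1 + x $ 1 * x $ 2 + x $ 2 * x $ 2 + x $ 3 * x $ 5 + x $ 4 * x $ 6"

lemma polar_minus_form:
  "polar minus_form v w = v $ 1 * w $ 2 + v $ 2 * w $ 1 + v $ 3 * w $ 5 + v $ 5 * w $ 3
     + v $ 4 * w $ 6 + v $ 6 * w $ 4"
proof -
  \<comment> \<open>The summand with factor 2 comes from the two squares and vanishes in
    characteristic 2.\<close>
  have "polar minus_form v w = v $ 1 * w $ 2 + v $ 2 * w $ 1 + v $ 3 * w $ 5 + v $ 5 * w $ 3
     + v $ 4 * w $ 6 + v $ 6 * w $ 4 + 2 * (v $ 1 * w $ 1 + v $ 2 * w $ 2)"
    unfolding polar_def minus_form_def vector_add_component by algebra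
  then show ?thesis
    unfolding bit_2_eq_0 by (simp only: mult_zero_left add_0_right)
qed

lemma polar_minus_form_vector:
  "polar minus_form (vector [a1, a2, a3, a4, a5, a6]) (vector [b1, b2, b3, b4, b5, b6]) =
    a1 * b2 + a2 * b1 + a3 * b5 + a5 * b3 + a4 * b6 + a6 * b4"
  unfolding polar_minus_form vector_6 ..

lemma quadratic_minus_form: "quadratic_form minus_form"
proof -
  have "minus_form (c *s v) = c\<^sup>2 * minus_form v" for c v
    by (cases c) (simp_all add: minus_form_def)
  then show ?thesis
    unfolding quadratic_form_def linear_functional_iff polar_minus_form
      vector_add_component vector_smult_component
    by (simp only: distrib_left distrib_right ac_simps) simp
qed

lemma nondegenerate_minus_form: "nondegenerate minus_form"
  unfolding nondegenerate_def
proof (intro allI impI)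
  fix v assume v: "\<forall>w. polar minus_form v w = 0"
  have "v $ i = 0" for i
  proof -
    have "polar minus_form v (axis j 1) = 0" for j
      using v by blast
    from this[of 1] this[of 2] this[of 3] this[of 4] this[of 5] this[of 6]
    show ?thesis
      using exhaust_6[of i] by (auto simp: polar_minus_form axis_def)
  qed
  then show "v = 0"
    by (simp add: vec_eq_iff)
qed

text \<open>If the dimension exceeded 2, projecting \<open>U\<close> to coordinates 5, 6 or to
  coordinates 3, 4 would have a kernel. Nonzero kernel vectors \<open>p\<close> and \<open>q\<close>
  then turn out to span \<open>U\<close>.\<close>

lemma totally_singular_minus_form_dim:
  assumes U: "totally_singular minus_form U"
  shows "vec.dim U \<le> 2"
proof -
  have sub: "vec.subspace U" and sing: "\<And>x. x \<in> U \<Longrightarrow> minus_form x = 0"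
    using U by (auto simp: totally_singular_def)
  have orth: "polar minus_form x y = 0" if "x \<in> U" "y \<in> U" for x y
    using that sing vec.subspace_add[OF sub] by (simp add: polar_def)
  have proj: "vec.dim U \<le> 2" if "\<And>x. x \<in> U \<Longrightarrow> x $ i = 0 \<Longrightarrow> x $ j = 0 \<Longrightarrow> x = 0" for i j
  proof -
    define \<pi> :: "bit ^ 6 \<Rightarrow> bit ^ 2" where "\<pi> x = vector [x $ i, x $ j]" for x
    have lin: "Vector_Spaces.linear (*s) (*s) \<pi>"
      by (simp add: linear_vec_iff \<pi>_def vec_eq_iff forall_2)
    have "inj_on \<pi> U"
      unfolding vec.linear_inj_on_iff_eq_0[OF lin sub]
      using that by (simp add: \<pi>_def vec_eq_iff forall_2)
    then have "vec.dim U = vec.dim (\<pi> ` U)"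
      using vec.dim_image_eq[OF lin, of U] vec.span_eq_iff sub by metis
    also have "\<dots> \<le> vec.dim (UNIV :: (bit ^ 2) set)"
      by (intro vec.dim_subset) simp
    finally show ?thesis
      unfolding vec_dim_card by simp
  qed
  show ?thesis
  proof (rule ccontr)
    assume "\<not> vec.dim U \<le> 2"
    then obtain p q where p: "p \<in> U" "p $ 5 = 0" "p $ 6 = 0" "p \<noteq> 0"
      and q: "q \<in> U" "q $ 3 = 0" "q $ 4 = 0" "q \<noteq> 0"
      using proj by metis
    \<comment> \<open>The plane on coordinates 1, 2 has no singular vector but 0, so
      \<open>p\<close> is supported on coordinates 3, 4 and \<open>q\<close> on coordinates 5,
      6.\<close>
    have anis: "a = 0 \<and> b = 0" if "a * a + a * b + b * b = 0" for a b :: bit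
      using that by (cases a; cases b) auto
    have p': "p $ 1 = 0" "p $ 2 = 0" and q': "q $ 1 = 0" "q $ 2 = 0"
      using anis[of "p $ 1" "p $ 2"] anis[of "q $ 1" "q $ 2"] sing[OF p(1)] sing[OF q(1)]
      unfolding minus_form_def p(2,3) q(2,3) mult_zero_left mult_zero_right add_0_right by blast+
    have pq: "p $ 3 * q $ 5 + p $ 4 * q $ 6 = 0"
      using orth[OF p(1) q(1)]
      unfolding polar_minus_form p(2,3) q(2,3) p' q' mult_zero_left mult_zero_right add_0_right add_0_left .
    have pne: "p $ 3 \<noteq> 0 \<or> p $ 4 \<noteq> 0" and qne: "q $ 5 \<noteq> 0 \<or> q $ 6 \<noteq> 0"
      using p q p' q' by (auto simp: vec_eq_iff forall_6)
    have "U \<subseteq> vec.span {p, q}"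
    proof
      fix r assume r: "r \<in> U"
      have rp: "p $ 3 * r $ 5 + p $ 4 * r $ 6 = 0" and rq: "q $ 5 * r $ 3 + q $ 6 * r $ 4 = 0"
        using orth[OF p(1) r] orth[OF q(1) r]
        unfolding polar_minus_form p(2,3) q(2,3) p' q' mult_zero_left mult_zero_right add_0_right add_0_left .
      \<comment> \<open>In a plane the annihilator of a nonzero vector is a line; by
        \<open>pq\<close> the annihilator of \<open>p\<close> is spanned by \<open>q\<close> and
        vice versa.\<close>
      have "\<exists>l m. r $ 3 = l * p $ 3 \<and> r $ 4 = l * p $ 4 \<and> r $ 5 = m * q $ 5 \<and> r $ 6 = m * q $ 6"
        using pq pne qne rp rq
        by (cases "p $ 3"; cases "p $ 4"; cases "q $ 5"; cases "q $ 6"; cases "r $ 3"; cases "r $ 5")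
          auto
      then obtain l m where lm: "r $ 3 = l * p $ 3" "r $ 4 = l * p $ 4"
        "r $ 5 = m * q $ 5" "r $ 6 = m * q $ 6"
        by blast
      have "minus_form r = 0"
        using sing r by blast
      moreover have "r $ 3 * r $ 5 + r $ 4 * r $ 6 = l * m * (p $ 3 * q $ 5 + p $ 4 * q $ 6)"
        unfolding lm by algebra
      ultimately have "r $ 1 = 0 \<and> r $ 2 = 0"
        using pq anis[of "r $ 1" "r $ 2"]
        unfolding minus_form_def by (simp only: add.assoc mult_zero_right add_0_right)
      then have "r = l *s p + m *s q"
        using lm p q p' q' by (simp add: vec_eq_iff forall_6)
      then show "r \<in> vec.span {p, q}"
        by (simp add: vec.span_add vec.span_base vec.span_scale)
    qed
    then have "vec.dim U \<le> card {p, q}"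
      by (intro vec.dim_le_card) auto
    also have "\<dots> \<le> 2"
      by (simp add: card_insert_if)
    finally show False
      using \<open>\<not> vec.dim U \<le> 2\<close> by blast
  qed
qed

lemma witt_index_minus_form: "witt_index minus_form = 2"
proof (rule antisym)
  show "witt_index minus_form \<le> 2"
    by (intro witt_index_le totally_singular_minus_form_dim) (simp_all add: minus_form_def)
  define f :: "bit ^ 2 \<Rightarrow> bit ^ 6" where "f x = vector [0, 0, x $ 1, x $ 2, 0, 0]" for x
  have "CARD(2) \<le> witt_index minus_form"
  proof (rule witt_index_ge_inj)
    show "Vector_Spaces.linear (*s) (*s) f"
      by (simp add: linear_vec_iff f_def vec_eq_iff forall_6 vector_6)
    show "inj f"
      by (rule injI) (simp add: f_def vec_eq_iff forall_6 forall_2 vector_6)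
    show "minus_form (f x) = 0" for x
      by (simp add: f_def minus_form_def vector_6)
  qed
  then show "2 \<le> witt_index minus_form"
    by simp
qed

subsection \<open>Recognising members of the class\<close>

lemma connected_graph_iso:
  assumes "graph_iso G H" "connected_graph G" "adj G \<subseteq> verts G \<times> verts G"
  shows "connected_graph H"
proof -
  obtain f where f: "bij_betw f (verts G) (verts H)"
    and fadj: "\<And>u v. u \<in> verts G \<Longrightarrow> v \<in> verts G \<Longrightarrow> (u, v) \<in> adj G \<longleftrightarrow> (f u, f v) \<in> adj H"
    using assms(1) unfolding graph_iso_def by blast
  have path: "(f u, f v) \<in> (adj H)\<^sup>*" if "(u, v) \<in> (adj G)\<^sup>*" for u v
    using that
  proof induction
    case (step y z)
    then have "(f y, f z) \<in> adj H"
      using fadj assms(3) by blast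
    then show ?case
      using step.IH by (simp add: rtrancl.rtrancl_into_rtrancl)
  qed simp
  have "verts H = f ` verts G"
    using f by (simp add: bij_betw_def)
  then show ?thesis
    using assms(2) path by (auto simp: connected_graph_def)
qed

text \<open>At most six vectors spanning a 6-space force \<open>g\<close> to be injective with
  independent image, so only the span and the Gram matrix have to be checked.\<close>

lemma induced_subgraph_in_class_E6I:
  fixes g :: "'a \<Rightarrow> bit ^ 6"
  assumes W: "finite W" "card W \<le> 6"
    and conn: "connected_graph (induced_subgraph G W)"
    and span: "vec.span (g ` W) = UNIV"
    and anis: "\<And>x. x \<in> W \<Longrightarrow> minus_form (g x) = 1"
    and gram: "\<And>x y. x \<in> W \<Longrightarrow> y \<in> W \<Longrightarrow> polar minus_form (g x) (g y) = of_bool ((x, y) \<in> adj G)"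
  shows "\<exists>H\<in>class_E6. graph_iso (induced_subgraph G W) H"
proof -
  have dim6: "vec.dim (UNIV :: (bit ^ 6) set) = 6"
    unfolding vec_dim_card by simp
  have "vec.dim (UNIV :: (bit ^ 6) set) \<le> card (g ` W)"
    by (intro vec.dim_le_card) (use span W in auto)
  then have "card (g ` W) = 6" "card (g ` W) = card W"
    using dim6 card_image_le[OF W(1), of g] W(2) by linarith+
  then have inj: "inj_on g W" and indep: "vec.independent (g ` W)"
    using W(1) span dim6 vec.card_le_dim_spanning[of "g ` W" UNIV]
    by (simp_all add: eq_card_imp_inj_on)
  \<comment> \<open>On anisotropic vectors the form of a sum equals the polar value, since 1 + 1 =
    0.\<close>
  have adj: "(x, y) \<in> adj G \<longleftrightarrow> g x \<noteq> g y \<and> minus_form (g x + g y) = 1" if "x \<in> W" "y \<in> W" for x y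
  proof (cases "g x = g y")
    case True
    then show ?thesis
      using gram[OF that] polar_self[OF quadratic_minus_form, of "g y"] by auto
  next
    case False
    then show ?thesis
      using gram[OF that] anis[OF that(1)] anis[OF that(2)] by (auto simp: polar_def of_bool_eq_iff)
  qed
  let ?H = "basis_graph minus_form (g ` W)"
  have iso: "graph_iso (induced_subgraph G W) ?H"
    unfolding graph_iso_def
  proof (intro exI[of _ g] conjI ballI)
    show "bij_betw g (verts (induced_subgraph G W)) (verts ?H)"
      using inj by (simp add: induced_subgraph_def basis_graph_def bij_betw_def)
    show "(x, y) \<in> adj (induced_subgraph G W) \<longleftrightarrow> (g x, g y) \<in> adj ?H"
      if "x \<in> verts (induced_subgraph G W)" "y \<in> verts (induced_subgraph G W)" for x y
      using that adj by (simp add: induced_subgraph_def basis_graph_def)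
  qed
  then have "connected_graph ?H"
    using connected_graph_iso[OF iso conn] by (simp add: induced_subgraph_def)
  then have "?H \<in> class_E6"
    unfolding class_E6_def
    using quadratic_minus_form nondegenerate_minus_form witt_index_minus_form indep span anis
    by blast
  then show ?thesis
    using iso by blast
qed

section \<open>Adding two vertices to a four-vertex configuration\<close>

text \<open>Coordinates 3 and 4 stay free: coordinate 3 of \<open>x\<close> and coordinate 4 of
  \<open>y\<close> adjust the values of the form, and coordinate 4 of \<open>x\<close> adjusts the
  polar value.\<close>

lemma minus_form_pair_exists:
  fixes p1 p2 r1 r2 t m :: bit
  obtains x y :: "bit ^ 6"
  where "minus_form x = 1" "minus_form y = 1" "polar minus_form x y = m"
    "x $ 1 = p1" "x $ 2 = p2" "x $ 5 = 1" "x $ 6 = 0"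
    "y $ 1 = r1" "y $ 2 = r2" "y $ 5 = t" "y $ 6 = 1"
proof -
  define c where "c = 1 + (p1 * p1 + p1 * p2 + p2 * p2)"
  define d where "d = 1 + (r1 * r1 + r1 * r2 + r2 * r2)"
  define e where "e = m + p1 * r2 + p2 * r1 + c * t"
  show thesis
  proof (rule that)
    show "minus_form (vector [p1, p2, c, e, 1, 0]) = 1"
      unfolding minus_form_def vector_6 c_def by (cases p1; cases p2) simp_all
    show "minus_form (vector [r1, r2, 0, d, t, 1]) = 1"
      unfolding minus_form_def vector_6 d_def by (cases r1; cases r2) simp_all
    have "polar minus_form (vector [p1, p2, c, e, 1, 0]) (vector [r1, r2, 0, d, t, 1]) =
        m + 2 * (p1 * r2 + p2 * r1 + c * t)"
      unfolding polar_minus_form vector_6 e_def by algebra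
    then show "polar minus_form (vector [p1, p2, c, e, 1, 0]) (vector [r1, r2, 0, d, t, 1]) = m"
      unfolding bit_2_eq_0 by (simp only: mult_zero_left add_0_right)
  qed (simp_all add: vector_6)
qed

text \<open>The form restricted to the span of \<open>X\<close> is the sum of an anisotropic plane and a radical of
  dimension 2, here \<open>\<langle>e\<^sub>3, e\<^sub>4\<rangle>\<close>. Two vertices \<open>u\<close>, \<open>v\<close> inducing independent functionals on the
  radical turn it into a hyperbolic 4-space, so the type is minus whatever the remaining
  adjacencies are.\<close>

lemma six_vertices_in_class_E6:
  fixes g :: "'a \<Rightarrow> bit ^ 6"
  assumes G: "simple_graph G"
    and uv: "u \<notin> X" "v \<notin> X" "u \<noteq> v" and X: "finite X" "card X \<le> 4"
    and conn: "connected_graph (induced_subgraph G (insert u (insert v X)))"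
    and span: "\<And>i. i \<in> {1, 2, 3, 4} \<Longrightarrow> axis i 1 \<in> vec.span (g ` X)"
    and anis: "\<And>x. x \<in> X \<Longrightarrow> minus_form (g x) = 1"
    and perp: "\<And>x. x \<in> X \<Longrightarrow> g x $ 5 = 0 \<and> g x $ 6 = 0"
    and gram: "\<And>x y. x \<in> X \<Longrightarrow> y \<in> X \<Longrightarrow> polar minus_form (g x) (g y) = of_bool ((x, y) \<in> adj G)"
    and u: "\<And>x. x \<in> X \<Longrightarrow> p1 * g x $ 2 + p2 * g x $ 1 + g x $ 3 = of_bool ((u, x) \<in> adj G)"
    and v: "\<And>x. x \<in> X \<Longrightarrow>
      r1 * g x $ 2 + r2 * g x $ 1 + t * g x $ 3 + g x $ 4 = of_bool ((v, x) \<in> adj G)"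
  shows "\<exists>H\<in>class_E6. graph_iso (induced_subgraph G (insert u (insert v X))) H"
proof -
  have sym: "(x, y) \<in> adj G \<longleftrightarrow> (y, x) \<in> adj G" and irr: "(x, x) \<notin> adj G" for x y
    using G by (auto simp: simple_graph_def sym_def irrefl_def)
  obtain x y where Qx: "minus_form x = 1" and Qy: "minus_form y = 1"
    and xy: "polar minus_form x y = of_bool ((u, v) \<in> adj G)"
    and x: "x $ 1 = p1" "x $ 2 = p2" "x $ 5 = 1" "x $ 6 = 0"
    and y: "y $ 1 = r1" "y $ 2 = r2" "y $ 5 = t" "y $ 6 = 1"
    using minus_form_pair_exists[of "of_bool ((u, v) \<in> adj G)" p1 p2 r1 r2 t] by metis
  define h where "h = g(u := x, v := y)"
  have hX: "h z = g z" if "z \<in> X" for z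
    using that uv by (auto simp: h_def)
  have hu: "h u = x" and hv: "h v = y"
    using uv by (simp_all add: h_def)
  let ?W = "insert u (insert v X)"
  \<comment> \<open>Coordinates 5 and 6 of \<open>g z\<close> vanish, so the left sides of the
    hypotheses \<open>u\<close> and \<open>v\<close> are the polar values with \<open>x\<close> and
    \<open>y\<close>.\<close>
  have xg: "polar minus_form x (g z) = of_bool ((u, z) \<in> adj G)" if "z \<in> X" for z
    using u[OF that] perp[OF that] by (simp only: polar_minus_form x) (simp add: add.commute)
  have yg: "polar minus_form y (g z) = of_bool ((v, z) \<in> adj G)" if "z \<in> X" for z
    using v[OF that] perp[OF that] by (simp only: polar_minus_form y) (simp add: add.commute)
  show ?thesis
  proof (rule induced_subgraph_in_class_E6I[where g = h])
    show "finite ?W" "card ?W \<le> 6"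
      using X by (simp_all add: card_insert_if)
    show "connected_graph (induced_subgraph G ?W)"
      by (rule conn)
    show "minus_form (h z) = 1" if "z \<in> ?W" for z
      using that hX hu hv Qx Qy anis by auto
    show "polar minus_form (h z) (h w) = of_bool ((z, w) \<in> adj G)" if "z \<in> ?W" "w \<in> ?W" for z w
    proof -
      have "polar minus_form (g z) x = of_bool ((z, u) \<in> adj G)"
        "polar minus_form (g z) y = of_bool ((z, v) \<in> adj G)" if "z \<in> X" for z
        using xg[OF that] yg[OF that] sym[of z]
        by (simp_all add: polar_commute[of _ "g z"])
      moreover have "polar minus_form y x = of_bool ((v, u) \<in> adj G)"
        using xy sym[of v] by (simp add: polar_commute[of _ y])
      ultimately show ?thesis
        using that hX hu hv xy xg yg gram irr polar_self[OF quadratic_minus_form] by auto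
    qed
    have img: "h ` ?W = insert x (insert y (g ` X))"
      using hX hu hv by auto
    define S where "S = vec.span (insert x (insert y (g ` X)))"
    have S: "\<And>z w. z \<in> S \<Longrightarrow> w \<in> S \<Longrightarrow> z + w \<in> S" "\<And>c z. z \<in> S \<Longrightarrow> c *s z \<in> S"
      by (auto simp: S_def vec.span_add vec.span_scale)
    have "axis i 1 \<in> S" if "i \<in> {1, 2, 3, 4}" for i
      using span[OF that] vec.span_mono[of "g ` X" "insert x (insert y (g ` X))"]
      by (auto simp: S_def)
    then have e: "axis 1 1 \<in> S" "axis 2 1 \<in> S" "axis 3 1 \<in> S" "axis 4 1 \<in> S"
      by simp_all
    have xS: "x \<in> S" "y \<in> S"
      by (auto simp: S_def vec.span_base)
    \<comment> \<open>In characteristic 2, adding the first four components again cancels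
      them.\<close>
    have "axis 5 1 = x + (x $ 1 *s axis 1 1 + x $ 2 *s axis 2 1 + x $ 3 *s axis 3 1 + x $ 4 *s axis 4 1)"
      by (auto simp: vec_eq_iff forall_6 axis_def x)
    then have e5: "axis 5 1 \<in> S"
      by (simp add: S e xS)
    have "axis 6 1 = y + (y $ 1 *s axis 1 1 + y $ 2 *s axis 2 1 + y $ 3 *s axis 3 1 + y $ 4 *s axis 4 1
        + y $ 5 *s axis 5 1)"
      by (auto simp: vec_eq_iff forall_6 axis_def y)
    then have e6: "axis 6 1 \<in> S"
      by (simp add: S e e5 xS)
    have "z \<in> S" for z
    proof -
      have "z = z $ 1 *s axis 1 1 + z $ 2 *s axis 2 1 + z $ 3 *s axis 3 1 + z $ 4 *s axis 4 1
        + z $ 5 *s axis 5 1 + z $ 6 *s axis 6 1"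
        by (auto simp: vec_eq_iff forall_6 axis_def)
      moreover have "\<dots> \<in> S"
        by (intro S e e5 e6)
      ultimately show ?thesis
        by simp
    qed
    then show "vec.span (h ` ?W) = UNIV"
      unfolding img S_def by blast
  qed
qed

lemma connected_star_extension:
  assumes G: "simple_graph G" and r: "r \<in> X" "\<And>x. x \<in> X \<Longrightarrow> x = r \<or> (r, x) \<in> adj G"
    and u: "\<exists>x\<in>X. (u, x) \<in> adj G" and v: "\<exists>x\<in>X. (v, x) \<in> adj G"
  shows "connected_graph (induced_subgraph G (insert u (insert v X)))"
proof -
  let ?W = "insert u (insert v X)"
  define E where "E = adj G \<inter> (?W \<times> ?W)"
  have "sym (adj G)"
    using G by (simp add: simple_graph_def)
  then have "sym E"
    unfolding E_def sym_def by blast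
  then have sym: "sym (E\<^sup>*)" and symE: "\<And>x y. (x, y) \<in> E \<Longrightarrow> (y, x) \<in> E"
    by (simp add: sym_rtrancl, simp add: symD)
  have X: "(r, x) \<in> E\<^sup>*" if "x \<in> X" for x
    using r that unfolding E_def by blast
  have ext: "(r, w) \<in> E\<^sup>*" if "x \<in> X" "(w, x) \<in> adj G" "w \<in> ?W" for x w
  proof -
    have "(w, x) \<in> E"
      using that unfolding E_def by blast
    then show ?thesis
      using symE X[OF that(1)] by (meson rtrancl.rtrancl_into_rtrancl)
  qed
  have root: "(r, w) \<in> E\<^sup>*" if "w \<in> ?W" for w
    using that X ext u v by blast
  have "(x, y) \<in> E\<^sup>*" if "x \<in> ?W" "y \<in> ?W" for x y
    using root[OF that(1)] root[OF that(2)] symD[OF sym] rtrancl_trans by metis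
  then show ?thesis
    by (simp add: connected_graph_def induced_subgraph_def E_def)
qed

subsection \<open>Krausz partition of a reduced graph\<close>

locale reduced_E6_free_graph =
  fixes G :: "'a sgraph"
  assumes simple: "simple_graph G"
    and twin_free: "x \<in> verts G \<Longrightarrow> y \<in> verts G \<Longrightarrow> (\<And>z. (z, x) \<in> adj G \<longleftrightarrow> (z, y) \<in> adj G) \<Longrightarrow> x = y"
    and E6_free: "W \<subseteq> verts G \<Longrightarrow> H \<in> class_E6 \<Longrightarrow> \<not> graph_iso (induced_subgraph G W) H"
begin

abbreviation E :: "'a \<Rightarrow> 'a \<Rightarrow> bool" where
  "E x y \<equiv> (x, y) \<in> adj G"

lemma E_sym: "E x y \<longleftrightarrow> E y x"
  using simple by (auto simp: simple_graph_def sym_def)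

lemma E_irrefl: "\<not> E x x"
  using simple by (auto simp: simple_graph_def irrefl_def)

lemma E_verts: "E x y \<Longrightarrow> x \<in> verts G" "E x y \<Longrightarrow> y \<in> verts G"
  using simple by (auto simp: simple_graph_def)

section \<open>Separating vertices and claws\<close>

lemma separate:
  assumes "x \<in> verts G" "y \<in> verts G" "x \<noteq> y"
  obtains z where "E z x \<noteq> E z y"
  using twin_free assms by blast

text \<open>The leaves have the same neighbours within the claw, so the images of \<open>a\<close>,
  \<open>d\<close> and of \<open>b\<close>, \<open>d\<close> have sums spanning the radical, namely
  axes 3 and 4. On these, \<open>u\<close> induces the functional (1, 0) and \<open>v\<close> the
  functional (0, 1).\<close>

lemma claw_separators:
  assumes claw: "E c a" "E c b" "E c d" "\<not> E a b" "\<not> E a d" "\<not> E b d"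
    and dist: "a \<noteq> b" "a \<noteq> d" "b \<noteq> d"
    and u: "E u a \<noteq> E u d" "E u b = E u d" and v: "E v b \<noteq> E v d" "E v a = E v d"
  shows False
proof -
  have claw': "E a c" "E b c" "E d c" "\<not> E b a" "\<not> E d a" "\<not> E d b"
    using claw E_sym by blast+
  have c: "c \<noteq> a" "c \<noteq> b" "c \<noteq> d"
    using claw E_irrefl by blast+
  let ?X = "{a, b, c, d}"
  \<comment> \<open>The default value serves as the image of \<open>b\<close>.\<close>
  define g :: "'a \<Rightarrow> bit ^ 6" where
    "g = (\<lambda>_. vector [0, 1, 0, 1, 0, 0])(a := vector [0, 1, 1, 0, 0, 0],
       c := vector [1, 0, 0, 0, 0, 0], d := vector [0, 1, 0, 0, 0, 0])"
  have g: "g a = vector [0, 1, 1, 0, 0, 0]" "g b = vector [0, 1, 0, 1, 0, 0]"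
    "g c = vector [1, 0, 0, 0, 0, 0]" "g d = vector [0, 1, 0, 0, 0, 0]"
    using c dist by (auto simp: g_def)
  have "\<exists>H\<in>class_E6. graph_iso (induced_subgraph G (insert u (insert v ?X))) H"
  \<comment> \<open>The coefficients are read off at \<open>c\<close> and \<open>d\<close>, whose
    images are axes 1 and 2; \<open>t = 0\<close> because \<open>v\<close> does not separate
    \<open>a\<close> from \<open>d\<close>.\<close>
  proof (rule six_vertices_in_class_E6[where g = g and ?p1.0 = "of_bool (E u d)"
        and ?p2.0 = "of_bool (E u c)" and ?r1.0 = "of_bool (E v d)" and ?r2.0 = "of_bool (E v c)"
        and t = 0])
    show "simple_graph G"
      by (rule simple)
    show "u \<notin> ?X" "v \<notin> ?X" "u \<noteq> v"
      using u v claw claw' E_irrefl by auto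
    show "finite ?X" "card ?X \<le> 4"
      by (simp_all add: card_insert_if)
    show "connected_graph (induced_subgraph G (insert u (insert v ?X)))"
      by (rule connected_star_extension[OF simple, of c]) (use claw u v in auto)
    have "axis 1 1 = g c" "axis 2 1 = g d" "axis 3 1 = g a + g d" "axis 4 1 = g b + g d"
      by (simp_all add: g vec_eq_iff forall_6 axis_def vector_6)
    then show "axis i 1 \<in> vec.span (g ` ?X)" if "i \<in> {1, 2, 3, 4}" for i
      using that by (auto intro!: vec.span_add intro: vec.span_base)
    show "minus_form (g x) = 1" if "x \<in> ?X" for x
      using that by (auto simp: g minus_form_def vector_6)
    show "g x $ 5 = 0 \<and> g x $ 6 = 0" if "x \<in> ?X" for x
      using that by (auto simp: g vector_6)
    show "polar minus_form (g x) (g y) = of_bool (E x y)" if "x \<in> ?X" "y \<in> ?X" for x y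
    proof -
      have "x = a \<or> x = b \<or> x = c \<or> x = d" "y = a \<or> y = b \<or> y = c \<or> y = d"
        using that by blast+
      then show ?thesis
        by (elim disjE; hypsubst; simp only: g polar_minus_form_vector)
          (simp_all add: claw claw' E_irrefl)
    qed
    show "of_bool (E u d) * g x $ 2 + of_bool (E u c) * g x $ 1 + g x $ 3 = of_bool (E u x)"
      if "x \<in> ?X" for x
      using that u by (auto simp: g vector_6)
    show "of_bool (E v d) * g x $ 2 + of_bool (E v c) * g x $ 1 + 0 * g x $ 3 + g x $ 4
      = of_bool (E v x)" if "x \<in> ?X" for x
      using that v by (auto simp: g vector_6)
  qed
  moreover have "insert u (insert v ?X) \<subseteq> verts G"
    using E_verts claw u v by blast
  ultimately show False
    using E6_free by blast
qed

lemma claw_free: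
  assumes claw: "E c a" "E c b" "E c d" and dist: "a \<noteq> b" "a \<noteq> d" "b \<noteq> d"
  shows "E a b \<or> E a d \<or> E b d"
proof (rule ccontr)
  assume "\<not> ?thesis"
  then have non: "\<not> E a b" "\<not> E a d" "\<not> E b d" "\<not> E b a" "\<not> E d a" "\<not> E d b"
    using E_sym by blast+
  have V: "a \<in> verts G" "b \<in> verts G" "d \<in> verts G"
    using claw E_verts by blast+
  obtain w1 where w1: "E w1 a \<noteq> E w1 b"
    using separate V dist by blast
  obtain w2 where w2: "E w2 a \<noteq> E w2 d"
    using separate V dist by blast
  obtain w3 where w3: "E w3 b \<noteq> E w3 d"
    using separate V dist by blast
  \<comment> \<open>A vertex separating two leaves singles out one of the three. If
    \<open>w1\<close>, \<open>w2\<close>, \<open>w3\<close> all singled out the same leaf, none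
    would separate the other two; so two of them can serve as \<open>u\<close> and
    \<open>v\<close>.\<close>
  show False
    using claw_separators[of c a b d] claw_separators[of c a d b] claw_separators[of c b d a]
      claw dist non w1 w2 w3 by metis
qed

section \<open>Odd triangles and diamonds\<close>

text \<open>Oddness certifies a common end: three edges forming a triangle of a multi-graph have
  indicator vectors with sum 0 modulo 2, so every edge is adjacent to an even number of
  them.\<close>

definition odd_triangle :: "'a \<Rightarrow> 'a \<Rightarrow> 'a \<Rightarrow> bool" where
  "odd_triangle x y z \<longleftrightarrow> E x y \<and> E y z \<and> E x z \<and> (\<exists>w. E w x \<noteq> (E w y \<noteq> E w z))"

lemma odd_triangle_swap12: "odd_triangle x y z \<longleftrightarrow> odd_triangle y x z"
  unfolding odd_triangle_def using E_sym by metis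

lemma odd_triangle_swap23: "odd_triangle x y z \<longleftrightarrow> odd_triangle x z y"
  unfolding odd_triangle_def using E_sym by metis

text \<open>The images of \<open>a\<close>, \<open>b\<close>, \<open>c\<close> and of
  \<open>d\<close>, \<open>b\<close>, \<open>c\<close> have sums spanning the radical, namely axes 3
  and 4. There \<open>u\<close> induces (1, 0) and \<open>v\<close> induces (\<open>t\<close>, 1),
  which are independent for either value of \<open>t\<close>.\<close>

lemma diamond_separators:
  assumes dia: "E a b" "E a c" "E b c" "E d b" "E d c" "\<not> E a d"
    and u: "E u a \<noteq> (E u b \<noteq> E u c)" "\<not> (E u d \<noteq> (E u b \<noteq> E u c))"
    and v: "E v d \<noteq> (E v b \<noteq> E v c)"
  shows False
proof -
  have dia': "E b a" "E c a" "E c b" "E b d" "E c d" "\<not> E d a"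
    using dia E_sym by blast+
  have dist: "a \<noteq> d" "a \<noteq> b" "a \<noteq> c" "b \<noteq> c" "b \<noteq> d" "c \<noteq> d"
    using u dia E_irrefl by blast+
  let ?X = "{a, b, c, d}"
  define g :: "'a \<Rightarrow> bit ^ 6" where
    "g = (\<lambda>_. vector [1, 1, 0, 1, 0, 0])(a := vector [1, 1, 1, 0, 0, 0],
       b := vector [1, 0, 0, 0, 0, 0], c := vector [0, 1, 0, 0, 0, 0])"
  have g: "g a = vector [1, 1, 1, 0, 0, 0]" "g b = vector [1, 0, 0, 0, 0, 0]"
    "g c = vector [0, 1, 0, 0, 0, 0]" "g d = vector [1, 1, 0, 1, 0, 0]"
    using dist by (auto simp: g_def)
  have "\<exists>H\<in>class_E6. graph_iso (induced_subgraph G (insert u (insert v ?X))) H"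
  proof (rule six_vertices_in_class_E6[where g = g and ?p1.0 = "of_bool (E u c)"
        and ?p2.0 = "of_bool (E u b)" and ?r1.0 = "of_bool (E v c)" and ?r2.0 = "of_bool (E v b)"
        and t = "of_bool (E v a \<noteq> (E v b \<noteq> E v c))"])
    show "simple_graph G"
      by (rule simple)
    show "u \<notin> ?X" "v \<notin> ?X" "u \<noteq> v"
      using u v dia dia' E_irrefl by auto
    show "finite ?X" "card ?X \<le> 4"
      by (simp_all add: card_insert_if)
    show "connected_graph (induced_subgraph G (insert u (insert v ?X)))"
      by (rule connected_star_extension[OF simple, of b]) (use dia dia' u v in auto)
    have "axis 1 1 = g b" "axis 2 1 = g c" "axis 3 1 = g a + g b + g c" "axis 4 1 = g d + g b + g c"
      by (simp_all add: g vec_eq_iff forall_6 axis_def vector_6)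
    then show "axis i 1 \<in> vec.span (g ` ?X)" if "i \<in> {1, 2, 3, 4}" for i
      using that by (auto intro!: vec.span_add intro: vec.span_base)
    show "minus_form (g x) = 1" if "x \<in> ?X" for x
      using that by (auto simp: g minus_form_def vector_6)
    show "g x $ 5 = 0 \<and> g x $ 6 = 0" if "x \<in> ?X" for x
      using that by (auto simp: g vector_6)
    show "polar minus_form (g x) (g y) = of_bool (E x y)" if "x \<in> ?X" "y \<in> ?X" for x y
    proof -
      have "x = a \<or> x = b \<or> x = c \<or> x = d" "y = a \<or> y = b \<or> y = c \<or> y = d"
        using that by blast+
      then show ?thesis
        by (elim disjE; hypsubst; simp only: g polar_minus_form_vector)
          (simp_all add: dia dia' E_irrefl)
    qed
    show "of_bool (E u c) * g x $ 2 + of_bool (E u b) * g x $ 1 + g x $ 3 = of_bool (E u x)"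
      if "x \<in> ?X" for x
      using that u by (auto simp: g vector_6)
    show "of_bool (E v c) * g x $ 2 + of_bool (E v b) * g x $ 1
        + of_bool (E v a \<noteq> (E v b \<noteq> E v c)) * g x $ 3 + g x $ 4 = of_bool (E v x)"
      if "x \<in> ?X" for x
      using that v by (auto simp: g vector_6)
  qed
  moreover have "insert u (insert v ?X) \<subseteq> verts G"
    using E_verts dia u v by blast
  ultimately show False
    using E6_free by blast
qed

text \<open>A vertex separating \<open>a\<close> from \<open>d\<close> has different parities on the
  two triangles, so one of them is odd. If both were, this vertex and a witness for the other
  triangle would contradict \<open>diamond_separators\<close>, up to exchanging \<open>a\<close> and
  \<open>d\<close>.\<close>

lemma diamond_odd_triangle:
  assumes dia: "E a b" "E a c" "E b c" "E d b" "E d c" "\<not> E a d" "a \<noteq> d"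
  shows "odd_triangle b c a \<longleftrightarrow> \<not> odd_triangle b c d"
proof -
  obtain w where w: "E w a \<noteq> E w d"
    using separate[of a d] dia E_verts by blast
  have sym: "E b a" "E c a" "E b d" "E c d" "\<not> E d a"
    using dia E_sym by blast+
  define P where "P z w \<longleftrightarrow> E w z \<noteq> (E w b \<noteq> E w c)" for z w
  have odd: "odd_triangle b c a \<longleftrightarrow> (\<exists>w. P a w)" "odd_triangle b c d \<longleftrightarrow> (\<exists>w. P d w)"
    unfolding odd_triangle_def P_def using dia sym by blast+
  have "P a w \<noteq> P d w"
    using w unfolding P_def by blast
  moreover have "\<not> (P a u \<and> \<not> P d u \<and> P d v)" for u v
    using diamond_separators[OF dia(1-6)] unfolding P_def by blast
  moreover have "\<not> (P d u \<and> \<not> P a u \<and> P a v)" for u v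
    using diamond_separators[OF dia(4,5,3,1,2) sym(5)] unfolding P_def by blast
  ultimately show ?thesis
    unfolding odd by blast
qed

section \<open>Lines, the prospective points of the multi-graph\<close>

definition line :: "'a \<Rightarrow> 'a \<Rightarrow> 'a set" where
  "line x y = {x, y} \<union> {z. odd_triangle x y z}"

lemma line_commute: "line x y = line y x"
  unfolding line_def using odd_triangle_swap12 by auto

lemma odd_triangle_if_K4:
  assumes "E x y" "E x z" "E y z" "E w x" "E w y" "E w z"
  shows "odd_triangle x y z"
  unfolding odd_triangle_def using assms by blast

text \<open>Two odd triangles on the edge \<open>x y\<close> cannot form a diamond, so their apices
  \<open>z\<close> and \<open>w\<close> are adjacent. Then \<open>y\<close> is adjacent to all of
  \<open>x\<close>, \<open>z\<close>, \<open>w\<close> and witnesses that this triangle is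
  odd.\<close>

lemma line_subset:
  assumes "odd_triangle x y z"
  shows "line x y \<subseteq> line x z"
proof
  fix w assume "w \<in> line x y"
  then consider "w \<in> {x, y, z}" | "odd_triangle x y w" "w \<noteq> z"
    unfolding line_def by blast
  then show "w \<in> line x z"
  proof cases
    case 1
    then show ?thesis
      using assms odd_triangle_swap23 unfolding line_def by blast
  next
    case 2
    have tri: "E x y" "E y z" "E x z" "E y w" "E x w" "E z x" "E z y" "E w x" "E w y"
      using assms 2 E_sym unfolding odd_triangle_def by blast+
    then have "E z w"
      using diamond_odd_triangle[of z x y w] assms 2 by blast
    then have "odd_triangle x z w"
      using odd_triangle_if_K4[of x z w y] tri E_sym by blast
    then show ?thesis
      unfolding line_def by blast
  qed
qed

text \<open>Both directions of \<open>line_subset\<close> show that a line is determined by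
  \<open>x\<close> and any further vertex on it. With \<open>line_commute\<close>, lines therefore
  partition the edges of the graph.\<close>

lemma line_eq:
  assumes "E x y" "z \<in> line x y" "z \<noteq> x"
  shows "E x z" "line x z = line x y"
proof -
  have "z = y \<or> odd_triangle x y z"
    using assms by (auto simp: line_def)
  then show "E x z" "line x z = line x y"
    using assms(1) line_subset[of x y z] line_subset[of x z y] odd_triangle_swap23[of x y z]
    by (auto simp: odd_triangle_def)
qed

definition lines_at :: "'a \<Rightarrow> 'a set set" where
  "lines_at x = {line x y | y. E x y}"

text \<open>A common line contains both vertices and so is \<open>line x y\<close> by
  \<open>line_eq\<close>. Adjacency thus becomes sharing exactly one point.\<close>

lemma lines_at_Int:
  assumes "x \<noteq> y"
  shows "lines_at x \<inter> lines_at y = (if E x y then {line x y} else {})"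
proof -
  have "E x y \<and> L = line x y" if L: "L \<in> lines_at x" "L \<in> lines_at y" for L
  proof -
    obtain a b where a: "E x a" "L = line x a" and b: "L = line y b"
      using L unfolding lines_at_def by blast
    have "y \<in> line x a"
      using a b by (auto simp: line_def)
    then show ?thesis
      using line_eq[OF a(1)] assms a by blast
  qed
  moreover have "line x y \<in> lines_at x \<inter> lines_at y" if "E x y"
    using that E_sym line_commute[of x y] by (auto simp: lines_at_def)
  ultimately show ?thesis
    by auto
qed

text \<open>Neighbours of \<open>x\<close> on three different lines would be pairwise non-adjacent
  and form a claw.\<close>

lemma three_lines_at:
  assumes E: "E x a" "E x b" "E x d"
    and ne: "line x a \<noteq> line x b" "line x a \<noteq> line x d" "line x b \<noteq> line x d"
  shows False
proof -
  have dist: "a \<noteq> b" "a \<noteq> d" "b \<noteq> d"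
    using ne by auto
  have not_odd: "\<not> odd_triangle x s t" if "E x s" "E x t" "line x s \<noteq> line x t" for s t
  proof
    assume "odd_triangle x s t"
    moreover from this have "t \<noteq> x"
      using E_irrefl by (auto simp: odd_triangle_def)
    ultimately show False
      using line_eq[of x s t] that by (auto simp: line_def)
  qed
  have one: "\<not> E s p"
    if "E x p" "E x s" "E x t" "p \<noteq> s" "p \<noteq> t" "s \<noteq> t"
      "line x p \<noteq> line x s" "line x p \<noteq> line x t" "line x s \<noteq> line x t" for p s t
  proof
    assume sp: "E s p"
    have no: "\<not> odd_triangle x p s" "\<not> odd_triangle x p t" "\<not> odd_triangle x s t"
      using not_odd that by blast+
    have "\<not> odd_triangle x s p"
      using no odd_triangle_swap23 by blast
    note no = no this
    have sym: "E p x" "E s x" "E t x" "E p s"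
      using that sp E_sym by blast+
    \<comment> \<open>As \<open>t\<close> is adjacent to \<open>x\<close> and the triangle
      \<open>x p s\<close> is not odd, \<open>t\<close> is adjacent to \<open>p\<close> or
      \<open>s\<close>. A diamond without an odd triangle is impossible, so it is adjacent to both
      and makes \<open>x p s\<close> odd after all.\<close>
    have tx: "E t p \<or> E t s"
    proof (rule ccontr)
      assume "\<not> ?thesis"
      then have "odd_triangle x p s"
        unfolding odd_triangle_def using that sym sp by blast
      then show False
        using no by blast
    qed
    then have "E t p \<and> E t s"
    proof (rule disjE)
      assume "E t p"
      then show ?thesis
        using diamond_odd_triangle[of s x p t] no that sym sp E_sym by metis
    next
      assume "E t s"
      then show ?thesis
        using diamond_odd_triangle[of p x s t] no that sym sp E_sym by metis
    qed
    then have "odd_triangle x p s"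
      using odd_triangle_if_K4[of x p s t] that sym by blast
    then show False
      using no by blast
  qed
  show False
    using claw_free[OF E dist] one[of b a d] one[of d a b] one[of d b a] E dist ne by metis
qed

lemma lines_at_card: "finite (lines_at x)" "card (lines_at x) \<le> 2"
proof -
  \<comment> \<open>This form treats infinite and large finite sets at once: both contain three
    elements.\<close>
  have "\<not> (finite (lines_at x) \<longrightarrow> 3 \<le> card (lines_at x))"
  proof
    assume "finite (lines_at x) \<longrightarrow> 3 \<le> card (lines_at x)"
    then obtain S where S: "S \<subseteq> lines_at x" "card S = 3"
      by (metis infinite_arbitrarily_large obtain_subset_with_card_n)
    then obtain K L M where "S = {K, L, M}" "K \<noteq> L" "K \<noteq> M" "L \<noteq> M"
      by (auto simp: card_3_iff)
    then show False
      using S(1) three_lines_at[of x] by (auto simp: lines_at_def)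
  qed
  then show "finite (lines_at x)" "card (lines_at x) \<le> 2"
    by auto
qed

text \<open>Vertices lying on fewer than two lines get private ends \<open>Inr (x, i)\<close>.\<close>

definition krausz_ends :: "'a \<Rightarrow> ('a set + 'a \<times> nat) set" where
  "krausz_ends x = lines_at x <+> {x} \<times> {..<2 - card (lines_at x)}"

lemma card_krausz_ends: "card (krausz_ends x) = 2"
  unfolding krausz_ends_def using lines_at_card[of x] by (simp add: card_Plus card_cartesian_product)

lemma card_krausz_ends_Int: "card (krausz_ends x \<inter> krausz_ends y) = 1 \<longleftrightarrow> E x y"
proof (cases "x = y")
  case True
  then show ?thesis
    using card_krausz_ends E_irrefl by simp
next
  case False
  \<comment> \<open>Private ends carry their own vertex, so distinct vertices share none.\<close>
  then have "krausz_ends x \<inter> krausz_ends y = Inl ` (lines_at x \<inter> lines_at y)"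
    unfolding krausz_ends_def by auto
  then show ?thesis
    using lines_at_Int[OF False] by (simp add: card_image)
qed

end

section \<open>Reduction to graphs without twins\<close>

lemma line_graph_if_E6_free:
  fixes \<Gamma> :: "'a sgraph"
  assumes simple: "simple_graph \<Gamma>"
    and free: "\<not> (\<exists>W H. W \<subseteq> verts \<Gamma> \<and> H \<in> class_E6 \<and> graph_iso (induced_subgraph \<Gamma> W) H)"
  shows "is_line_graph_of_multigraph \<Gamma>"
proof -
  have sym: "(x, y) \<in> adj \<Gamma> \<longleftrightarrow> (y, x) \<in> adj \<Gamma>" and V: "(x, y) \<in> adj \<Gamma> \<Longrightarrow> x \<in> verts \<Gamma> \<and> y \<in> verts \<Gamma>"
    for x y
    using simple by (auto simp: simple_graph_def sym_def)
  define N where "N x = {z. (x, z) \<in> adj \<Gamma>}" for x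
  \<comment> \<open>Picks one representative for each neighbourhood.\<close>
  define r where "r = (\<lambda>x. inv_into (verts \<Gamma>) N (N x))"
  have r: "r x \<in> verts \<Gamma>" "N (r x) = N x" if "x \<in> verts \<Gamma>" for x
    using that unfolding r_def by (simp_all add: inv_into_into f_inv_into_f)
  have r_adj: "(r x, r y) \<in> adj \<Gamma> \<longleftrightarrow> (x, y) \<in> adj \<Gamma>" if "x \<in> verts \<Gamma>" "y \<in> verts \<Gamma>" for x y
    using r[OF that(1)] r[OF that(2)] sym unfolding N_def by blast
  define G where "G = induced_subgraph \<Gamma> (r ` verts \<Gamma>)"
  interpret G: reduced_E6_free_graph G
  proof
    show "simple_graph G"
      using simple
      by (auto simp: G_def simple_graph_def induced_subgraph_def sym_def irrefl_def)
    show "x = y" if xy: "x \<in> verts G" "y \<in> verts G"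
      and tw: "\<And>z. (z, x) \<in> adj G \<longleftrightarrow> (z, y) \<in> adj G" for x y
    proof -
      have x: "x \<in> r ` verts \<Gamma>" "x \<in> verts \<Gamma>" and y: "y \<in> r ` verts \<Gamma>" "y \<in> verts \<Gamma>"
        using xy r(1) by (auto simp: G_def induced_subgraph_def)
      have "(x, z) \<in> adj \<Gamma> \<longleftrightarrow> (y, z) \<in> adj \<Gamma>" if z: "z \<in> verts \<Gamma>" for z
      proof -
        \<comment> \<open>The vertex \<open>z\<close> may lie outside \<open>G\<close>; its
          representative \<open>r z\<close> lies in \<open>G\<close> and tests the same
          adjacencies.\<close>
        have "(r z, w) \<in> adj \<Gamma> \<longleftrightarrow> (z, w) \<in> adj \<Gamma>" for w
          using r(2)[OF z] by (auto simp: N_def)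
        then show ?thesis
          using tw[of "r z"] z x(1) y(1) sym by (auto simp: G_def induced_subgraph_def)
      qed
      then have "N x = N y"
        using V unfolding N_def by blast
      moreover have "r x = x" "r y = y"
        using x(1) y(1) r(2) by (auto simp: r_def)
      ultimately show ?thesis
        unfolding r_def by metis
    qed
    show "\<not> graph_iso (induced_subgraph G W) H" if "W \<subseteq> verts G" "H \<in> class_E6" for W H
    proof -
      have W: "W \<subseteq> r ` verts \<Gamma>"
        using that by (simp add: G_def induced_subgraph_def)
      then have "induced_subgraph G W = induced_subgraph \<Gamma> W"
        by (auto simp: G_def induced_subgraph_def)
      moreover have "W \<subseteq> verts \<Gamma>"
        using W r(1) by auto
      ultimately show ?thesis
        using free that(2) by metis
    qed
  qed
  \<comment> \<open>Vertices with the same representative become parallel edges, in accordance with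
    their being non-adjacent.\<close>
  define D where "D = \<lparr>mverts = UNIV, medges = verts \<Gamma>, ends = (\<lambda>x. G.krausz_ends (r x))\<rparr>"
  have "multi_graph D"
    by (simp add: multi_graph_def D_def G.card_krausz_ends)
  moreover have "graph_iso \<Gamma> (line_graph D)"
    unfolding graph_iso_def
  proof (intro exI[of _ id] conjI ballI)
    show "bij_betw id (verts \<Gamma>) (verts (line_graph D))"
      by (simp add: line_graph_def D_def)
    show "(x, y) \<in> adj \<Gamma> \<longleftrightarrow> (id x, id y) \<in> adj (line_graph D)"
      if "x \<in> verts \<Gamma>" "y \<in> verts \<Gamma>" for x y
    proof -
      have "(x, y) \<in> adj \<Gamma> \<longleftrightarrow> (r x, r y) \<in> adj G"
        using r_adj[OF that] that by (simp add: G_def induced_subgraph_def)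
      then show ?thesis
        using that G.card_krausz_ends_Int[of "r x" "r y"] by (simp add: line_graph_def D_def)
    qed
  qed
  ultimately show ?thesis
    by (rule is_line_graph_of_multigraphI)
qed

subsection \<open>Line graphs avoid the class\<close>

text \<open>Vertices are added one at a time, each adjacent to an earlier one. The new pair meets
  the earlier union, so it contributes at most one new point.\<close>

lemma connected_graph_union_card:
  assumes fin: "finite (verts H)" and conn: "connected_graph H" and H: "adj H \<subseteq> verts H \<times> verts H"
    and S: "\<And>x. x \<in> verts H \<Longrightarrow> card (S x) = 2"
    and meet: "\<And>x y. (x, y) \<in> adj H \<Longrightarrow> S x \<inter> S y \<noteq> {}"
    and ne: "verts H \<noteq> {}"
  shows "card (\<Union> (S ` verts H)) \<le> card (verts H) + 1"
proof -
  have finS: "finite (S x)" if "x \<in> verts H" for x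
    using S[OF that] card.infinite by fastforce
  have "\<exists>C\<subseteq>verts H. card C = Suc k \<and> card (\<Union> (S ` C)) \<le> Suc k + 1" if "Suc k \<le> card (verts H)" for k
    using that
  proof (induction k)
    case 0
    obtain x where "x \<in> verts H"
      using ne by blast
    then show ?case
      using S by (intro exI[of _ "{x}"]) simp
  next
    case (Suc k)
    then obtain C where C: "C \<subseteq> verts H" "card C = Suc k" "card (\<Union> (S ` C)) \<le> Suc k + 1"
      by auto
    obtain c0 where c0: "c0 \<in> C"
      using C(2) by fastforce
    obtain b0 where b0: "b0 \<in> verts H" "b0 \<notin> C"
      using C Suc.prems by (metis Suc_n_not_le_n subsetI subset_antisym)
    have "(c0, b0) \<in> (adj H)\<^sup>*"
      using conn C(1) c0 b0(1) by (auto simp: connected_graph_def)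
    \<comment> \<open>Otherwise everything reachable from \<open>c0\<close> would stay in
      \<open>C\<close>, including \<open>b0\<close>.\<close>
    then have "\<not> adj H `` C \<subseteq> C"
      using Image_closed_trancl[of "adj H" C] c0 b0(2) by blast
    then obtain c b where cb: "c \<in> C" "b \<notin> C" "(c, b) \<in> adj H"
      by blast
    have b: "b \<in> verts H"
      using cb(3) H by blast
    have finC: "finite C" "finite (\<Union> (S ` C))"
      using C(1) fin finite_subset finS by blast+
    obtain p where "p \<in> S c" "p \<in> S b"
      using meet[OF cb(3)] by blast
    then have "S b - \<Union> (S ` C) \<subset> S b"
      using cb(1) by blast
    then have "card (S b - \<Union> (S ` C)) < 2"
      using psubset_card_mono[OF finS[OF b]] S[OF b] by metis
    moreover have "\<Union> (S ` insert b C) = \<Union> (S ` C) \<union> (S b - \<Union> (S ` C))"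
      by auto
    then have "card (\<Union> (S ` insert b C)) \<le> card (\<Union> (S ` C)) + card (S b - \<Union> (S ` C))"
      using card_Un_le by metis
    ultimately have "card (\<Union> (S ` insert b C)) \<le> Suc (Suc k) + 1"
      using C(3) by linarith
    moreover have "card (insert b C) = Suc (Suc k)" "insert b C \<subseteq> verts H"
      using finC(1) cb(2) C b by auto
    ultimately show ?case
      by blast
  qed
  \<comment> \<open>A subset of full size is all of \<open>verts H\<close>.\<close>
  from this[of "card (verts H) - 1"] show ?thesis
    using fin ne by (auto simp: card_gt_0_iff Suc_le_eq dest!: card_subset_eq[OF fin])
qed

section \<open>Pairs as even weight vectors in dimension 7\<close>

lemma sum_UNIV_of_bool_mem:
  "(\<Sum>i\<in>UNIV. of_bool (i \<in> T)) = (of_nat (card T) :: 'b::semiring_1)" for T :: "'a::finite set"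
  by simp

text \<open>On vectors of even weight \<open>w\<close> this is \<open>w / 2 mod 2\<close>.\<close>

definition pair_form :: "bit ^ 7 \<Rightarrow> bit" where
  "pair_form x = x $ 1 * x $ 2 + (x $ 1 + x $ 2) * x $ 3 + (x $ 1 + x $ 2 + x $ 3) * x $ 4
     + (x $ 1 + x $ 2 + x $ 3 + x $ 4) * x $ 5 + (x $ 1 + x $ 2 + x $ 3 + x $ 4 + x $ 5) * x $ 6
     + (x $ 1 + x $ 2 + x $ 3 + x $ 4 + x $ 5 + x $ 6) * x $ 7"

text \<open>\<open>pair_form\<close> is the second elementary symmetric polynomial. On vectors of
  even weight the first product vanishes and the dot product remains.\<close>

lemma polar_pair_form:
  "polar pair_form x y = (\<Sum>i\<in>UNIV. x $ i) * (\<Sum>i\<in>UNIV. y $ i) - (\<Sum>i\<in>UNIV. x $ i * y $ i)"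
  unfolding polar_def pair_form_def vector_add_component sum_7 by algebra

lemma pair_form_pair:
  assumes "card T = 2"
  shows "pair_form (\<chi> i. of_bool (i \<in> T)) = 1"
proof -
  obtain i j where T: "T = {i, j}" "i \<noteq> j"
    using assms by (auto simp: card_2_iff)
  show ?thesis
    unfolding T(1) using exhaust_7[of i] exhaust_7[of j] T(2)
    by (elim disjE) (simp_all add: pair_form_def)
qed

text \<open>Sending basis vectors to the indicators of their pairs extends to an isometry onto the
  even weight vectors, along which the simplex code is pulled back.\<close>

lemma witt_index_ge_3_if_pairs:
  fixes Q :: "bit ^ 6 \<Rightarrow> bit" and S :: "bit ^ 6 \<Rightarrow> 'v set"
  assumes Q: "quadratic_form Q" "nondegenerate Q"
    and B: "vec.independent B" "vec.span B = UNIV" "\<And>b. b \<in> B \<Longrightarrow> Q b = 1"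
    and conn: "connected_graph (basis_graph Q B)"
    and S: "\<And>b. b \<in> B \<Longrightarrow> card (S b) = 2"
    and gram: "\<And>b c. b \<in> B \<Longrightarrow> c \<in> B \<Longrightarrow> b \<noteq> c \<Longrightarrow> Q (b + c) = 1 \<longleftrightarrow> card (S b \<inter> S c) = 1"
  shows "3 \<le> witt_index Q"
proof -
  have "vec.dim (vec.span B) = 6"
    unfolding B(2) vec_dim_card by simp
  then have B6: "card B = 6" "finite B"
    using vec.dim_span_eq_card_independent[OF B(1)] card.infinite[of B] by auto
  let ?X = "\<Union> (S ` B)"
  \<comment> \<open>Six connected pairs cover at most seven points, so they can be moved into the
    type \<open>7\<close>.\<close>
  have "card ?X \<le> card B + 1"
    using connected_graph_union_card[OF _ conn, of S] B6 S gram
    by (fastforce simp: basis_graph_def)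
  moreover have "finite ?X"
    using B6(2) S card.infinite by fastforce
  ultimately obtain \<iota> :: "'v \<Rightarrow> 7" where \<iota>: "inj_on \<iota> ?X"
    using card_le_inj[of ?X "UNIV :: 7 set"] B6(1) by auto
  define T where "T b = \<iota> ` S b" for b
  have T2: "card (T b) = 2" if "b \<in> B" for b
  proof -
    have "inj_on \<iota> (S b)"
      using that by (intro inj_on_subset[OF \<iota>]) auto
    then show ?thesis
      using S[OF that] by (simp add: T_def card_image)
  qed
  have TInt: "card (T b \<inter> T c) = card (S b \<inter> S c)" if "b \<in> B" "c \<in> B" for b c
  proof -
    have "T b \<inter> T c = \<iota> ` (S b \<inter> S c)"
      unfolding T_def using that by (intro inj_on_image_Int[OF \<iota>, symmetric]) auto
    moreover have "inj_on \<iota> (S b \<inter> S c)"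
      using that by (intro inj_on_subset[OF \<iota>]) auto
    ultimately show ?thesis
      using card_image by metis
  qed
  obtain \<phi> :: "bit ^ 6 \<Rightarrow> bit ^ 7" where \<phi>: "Vector_Spaces.linear (*s) (*s) \<phi>"
    and \<phi>B: "\<And>b. b \<in> B \<Longrightarrow> \<phi> b = (\<chi> i. of_bool (i \<in> T b))"
    using vec.linear_independent_extend[OF B(1), of "\<lambda>b. \<chi> i. of_bool (i \<in> T b)"] by blast
  have \<phi>_add: "\<phi> (v + w) = \<phi> v + \<phi> w" and \<phi>_scale: "\<phi> (c *s v) = c *s \<phi> v" for v w c
    using \<phi> by (simp_all add: linear_vec_iff)
  have \<phi>_0: "\<phi> 0 = 0"
    using \<phi>_scale[of 0 0] by simp
  have p_add: "polar Q (v + v') w = polar Q v w + polar Q v' w"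
    and p_scale: "polar Q (c *s v) w = c * polar Q v w" for v v' w c
    using Q(1) unfolding quadratic_form_def linear_functional_iff by blast+
  have p_0: "polar Q 0 w = 0" for w
    using p_scale[of 0 0 w] by simp
  define dot :: "bit ^ 7 \<Rightarrow> bit ^ 7 \<Rightarrow> bit" where "dot x y = (\<Sum>i\<in>UNIV. x $ i * y $ i)" for x y
  have dot_add: "dot (x + x') y = dot x y + dot x' y" and dot_scale: "dot (c *s x) y = c * dot x y"
    and dot_0: "dot 0 y = 0" and dot_commute: "dot x y = dot y x" for x x' y c
    unfolding dot_def vector_add_component vector_smult_component distrib_right sum.distrib
      sum_distrib_left mult.assoc zero_index
    by (simp_all only: mult_zero_left sum.neutral_const mult.commute)
  have dotB: "polar Q b c = dot (\<phi> b) (\<phi> c)" if b: "b \<in> B" and c: "c \<in> B" for b c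
  proof -
    have "\<phi> b $ i * \<phi> c $ i = of_bool (i \<in> T b \<inter> T c)" for i
      by (simp add: \<phi>B b c)
    then have dot: "dot (\<phi> b) (\<phi> c) = of_nat (card (T b \<inter> T c))"
      unfolding dot_def by (simp only: sum_UNIV_of_bool_mem)
    show ?thesis
    proof (cases "b = c")
      case True
      then show ?thesis
        using dot T2[OF c] polar_self[OF Q(1)] by simp
    next
      case False
      have "card (T b \<inter> T c) \<le> 2"
        using T2[OF b] card_mono[of "T b" "T b \<inter> T c"] by simp
      then consider "card (T b \<inter> T c) = 0" | "card (T b \<inter> T c) = 1" | "card (T b \<inter> T c) = 2"
        by linarith
      moreover have "Q (b + c) = 1 \<longleftrightarrow> card (T b \<inter> T c) = 1"
        unfolding TInt[OF b c] by (rule gram[OF b c False])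
      \<comment> \<open>Modulo 2, disjoint pairs and equal pairs both count as 0.\<close>
      ultimately have "of_nat (card (T b \<inter> T c)) = Q (b + c)"
        by cases simp_all
      then show ?thesis
        unfolding dot polar_def using B(3) b c by simp
    qed
  qed
  \<comment> \<open>The identity is extended from \<open>B\<close> in one argument at a time, with
    symmetry used in between.\<close>
  have "polar Q v c = dot (\<phi> v) (\<phi> c)" if c: "c \<in> B" for v c
  proof -
    have "v \<in> vec.span B"
      by (simp add: B(2))
    then show ?thesis
      by (rule vec.span_induct)
        (use c dotB in \<open>auto intro!: vec.subspaceI simp only: mem_Collect_eq p_add p_scale p_0 dot_add
          dot_scale dot_0 \<phi>_add \<phi>_scale \<phi>_0\<close>)
  qed
  then have dotB': "polar Q v c = dot (\<phi> v) (\<phi> c)" if "v \<in> B" for v c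
    using that dot_commute polar_commute by metis
  have isometry: "polar Q v w = dot (\<phi> v) (\<phi> w)" for v w
  proof -
    have "v \<in> vec.span B"
      by (simp add: B(2))
    then show ?thesis
      by (rule vec.span_induct)
        (use dotB' in \<open>auto intro!: vec.subspaceI simp only: mem_Collect_eq p_add p_scale p_0 dot_add
          dot_scale dot_0 \<phi>_add \<phi>_scale \<phi>_0\<close>)
  qed
  define Ev :: "(bit ^ 7) set" where "Ev = {x. (\<Sum>i\<in>UNIV. x $ i) = 0}"
  have Ev_dot: "Ev = {x. dot x 1 = 0}"
    unfolding Ev_def dot_def one_index mult_1_right ..
  have Ev: "vec.subspace Ev"
    unfolding Ev_dot by (rule vec.subspaceI)
      (simp_all only: mem_Collect_eq dot_add dot_scale dot_0 add_0_right mult_zero_right)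
  have even: "\<phi> v \<in> Ev" for v
  proof -
    have "v \<in> vec.span B"
      by (simp add: B(2))
    then show ?thesis
    proof (rule vec.span_induct)
      show "vec.subspace {v. \<phi> v \<in> Ev}"
        using Ev by (auto intro!: vec.subspaceI simp: \<phi>_0 \<phi>_add \<phi>_scale vec.subspace_add
            vec.subspace_scale vec.subspace_0)
      show "\<phi> b \<in> Ev" if "b \<in> B" for b
        unfolding Ev_def \<phi>B[OF that] mem_Collect_eq vec_lambda_beta sum_UNIV_of_bool_mem T2[OF that]
        by simp
    qed
  qed
  \<comment> \<open>By \<open>isometry\<close>, the kernel of \<open>\<phi>\<close> lies in the
    radical of the polar form.\<close>
  have "inj \<phi>"
    unfolding vec.linear_inj_iff_eq_0[OF \<phi>]
    using Q(2) isometry dot_0 unfolding nondegenerate_def by metis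
  have "vec.dim (range \<phi>) = CARD(6)"
    using vec.dim_image_eq[OF \<phi>, of UNIV] \<open>inj \<phi>\<close> unfolding vec.span_UNIV vec_dim_card by blast
  moreover have "vec.dim Ev < vec.dim (UNIV :: (bit ^ 7) set)"
  proof (rule vec.dim_psubset)
    have "axis 1 1 \<notin> Ev"
      by (simp add: Ev_def sum_7 axis_def)
    moreover have "vec.span Ev = Ev"
      using Ev by simp
    ultimately show "vec.span Ev \<subset> vec.span UNIV"
      unfolding vec.span_UNIV by blast
  qed
  ultimately have "vec.dim Ev \<le> vec.dim (range \<phi>)"
    unfolding vec_dim_card by simp
  then have range: "range \<phi> = Ev"
    using even by (intro vec.subspace_dim_equal) (auto simp: Ev \<phi> vec.linear_subspace_image)
  \<comment> \<open>Both sides have the same polar form and take the value 1 on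
    \<open>B\<close>.\<close>
  have Q_pair: "Q v = pair_form (\<phi> v)" for v
  proof -
    have Q_scale: "Q (c *s w) = c\<^sup>2 * Q w" for c w
      using Q(1) unfolding quadratic_form_def by blast
    have Q0: "Q 0 = 0"
      using Q_scale[of 0 0] by simp
    have "polar Q x y = polar pair_form (\<phi> x) (\<phi> y)" for x y
      using isometry[of x y] even[of x] even[of y]
      unfolding polar_pair_form dot_def Ev_def by simp
    then have add: "Q (x + y) = pair_form (\<phi> (x + y))"
      if "Q x = pair_form (\<phi> x)" "Q y = pair_form (\<phi> y)" for x y
      using that unfolding polar_def \<phi>_add by (metis diff_add_cancel)
    have "v \<in> vec.span B"
      by (simp add: B(2))
    then show ?thesis
    proof (rule vec.span_induct)
      show "vec.subspace {v. Q v = pair_form (\<phi> v)}"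
      proof (rule vec.subspaceI)
        show zero: "0 \<in> {v. Q v = pair_form (\<phi> v)}"
          by (simp add: Q0 \<phi>_0 pair_form_def)
        show "x + y \<in> {v. Q v = pair_form (\<phi> v)}"
          if "x \<in> {v. Q v = pair_form (\<phi> v)}" "y \<in> {v. Q v = pair_form (\<phi> v)}" for x y
          using add that by simp
        show "c *s x \<in> {v. Q v = pair_form (\<phi> v)}"
          if "x \<in> {v. Q v = pair_form (\<phi> v)}" for c x
          using that zero by (cases c) simp_all
      qed
      show "Q b = pair_form (\<phi> b)" if "b \<in> B" for b
        using B(3) that T2 \<phi>B pair_form_pair by simp
    qed
  qed
  \<comment> \<open>The simplex code: its coordinates are the seven nonzero functionals on
    \<open>bit ^ 3\<close>, so every nonzero codeword has weight 4, where \<open>pair_form\<close>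
    is 0.\<close>
  define h :: "bit ^ 3 \<Rightarrow> bit ^ 7" where
    "h c = vector [c $ 1, c $ 2, c $ 3, c $ 1 + c $ 2, c $ 1 + c $ 3, c $ 2 + c $ 3,
       c $ 1 + c $ 2 + c $ 3]" for c
  have h: "Vector_Spaces.linear (*s) (*s) h"
    unfolding linear_vec_iff vec_eq_iff forall_7 h_def vector_7 vector_add_component
      vector_smult_component by (simp only: distrib_left ac_simps simp_thms)
  then have h_add: "h (x + y) = h x + h y" and h_scale: "h (c *s x) = c *s h x" for x y c
    by (simp_all add: linear_vec_iff)
  have "h c \<in> Ev" for c
    by (cases "c $ 1"; cases "c $ 2"; cases "c $ 3") (simp_all add: Ev_def h_def sum_7 vector_7)
  then have \<phi>h: "\<phi> (inv \<phi> (h c)) = h c" for c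
    using range by (simp add: f_inv_into_f)
  have "CARD(3) \<le> witt_index Q"
  proof (rule witt_index_ge_inj)
    show "Vector_Spaces.linear (*s) (*s) (\<lambda>c. inv \<phi> (h c))"
      unfolding linear_vec_iff
    proof (intro conjI allI)
      show "inv \<phi> (h (x + y)) = inv \<phi> (h x) + inv \<phi> (h y)" for x y
        by (rule injD[OF \<open>inj \<phi>\<close>]) (simp only: \<phi>_add \<phi>h, simp only: h_add)
      show "inv \<phi> (h (c *s x)) = c *s inv \<phi> (h x)" for c x
        by (rule injD[OF \<open>inj \<phi>\<close>]) (simp only: \<phi>_scale \<phi>h, simp only: h_scale)
    qed
    show "inj (\<lambda>c. inv \<phi> (h c))"
    proof (rule injI)
      fix c d assume "inv \<phi> (h c) = inv \<phi> (h d)"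
      then have "h c = h d"
        using \<phi>h by metis
      then show "c = d"
        by (simp add: h_def vec_eq_iff forall_7 forall_3 vector_7)
    qed
    show "Q (inv \<phi> (h c)) = 0" for c
      unfolding Q_pair \<phi>h
      by (cases "c $ 1"; cases "c $ 2"; cases "c $ 3") (simp_all add: pair_form_def h_def vector_7)
  qed
  then show ?thesis
    by simp
qed

lemma E6_free_if_line_graph:
  fixes \<Gamma> :: "'a sgraph"
  assumes "is_line_graph_of_multigraph \<Gamma>" and W: "W \<subseteq> verts \<Gamma>" and H: "H \<in> class_E6"
  shows "\<not> graph_iso (induced_subgraph \<Gamma> W) H"
proof
  assume "graph_iso (induced_subgraph \<Gamma> W) H"
  obtain Q :: "bit ^ 6 \<Rightarrow> bit" and B where HQ: "H = basis_graph Q B"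
    and Q: "quadratic_form Q" "nondegenerate Q" "witt_index Q = 2"
    and B: "vec.independent B" "vec.span B = UNIV" "\<And>b. b \<in> B \<Longrightarrow> Q b = 1"
    and conn: "connected_graph (basis_graph Q B)"
    using H unfolding class_E6_def by blast
  obtain g where g: "bij_betw g W B"
    and gadj: "\<And>x y. x \<in> W \<Longrightarrow> y \<in> W \<Longrightarrow>
      (x, y) \<in> adj \<Gamma> \<longleftrightarrow> g x \<noteq> g y \<and> Q (g x + g y) = 1"
  proof -
    obtain g where g: "bij_betw g W B" and gadj: "\<forall>x\<in>W. \<forall>y\<in>W. (x, y) \<in> adj \<Gamma> \<inter> W \<times> W \<longleftrightarrow>
        (g x, g y) \<in> {(v, w). v \<in> B \<and> w \<in> B \<and> v \<noteq> w \<and> Q (v + w) = 1}"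
      using \<open>graph_iso (induced_subgraph \<Gamma> W) H\<close>
      unfolding graph_iso_def HQ induced_subgraph_def basis_graph_def by auto
    have "g x \<in> B" if "x \<in> W" for x
      using g that by (rule bij_betw_apply)
    then show thesis
      using that[OF g] gadj by simp
  qed
  obtain D :: "('a \<times> bool, 'a) multigraph" and f where D: "multi_graph D"
    and f: "bij_betw f (verts \<Gamma>) (verts (line_graph D))"
    and fadj: "\<And>x y. x \<in> verts \<Gamma> \<Longrightarrow> y \<in> verts \<Gamma> \<Longrightarrow>
      (x, y) \<in> adj \<Gamma> \<longleftrightarrow> (f x, f y) \<in> adj (line_graph D)"
    using assms(1) unfolding is_line_graph_of_multigraph_def graph_iso_def by blast
  have fE: "f x \<in> medges D" if "x \<in> verts \<Gamma>" for x
    using bij_betw_apply[OF f that] by (simp add: line_graph_def)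
  \<comment> \<open>The pair assigned to a basis vector \<open>b\<close> will be the ends of the
    edge \<open>f (k b)\<close>.\<close>
  define k where "k = inv_into W g"
  have k: "k b \<in> W" "g (k b) = b" if "b \<in> B" for b
    using that g unfolding k_def bij_betw_def by (auto simp: inv_into_into f_inv_into_f)
  have kE: "k b \<in> verts \<Gamma>" "f (k b) \<in> medges D" if "b \<in> B" for b
    using k(1)[OF that] W fE by blast+
  have "3 \<le> witt_index Q"
  proof (rule witt_index_ge_3_if_pairs[OF Q(1,2) B conn])
    show "card (ends D (f (k b))) = 2" if "b \<in> B" for b
      using D kE(2)[OF that] by (simp add: multi_graph_def)
    show "Q (b + c) = 1 \<longleftrightarrow> card (ends D (f (k b)) \<inter> ends D (f (k c))) = 1"
      if "b \<in> B" "c \<in> B" "b \<noteq> c" for b c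
      using gadj[of "k b" "k c"] fadj[of "k b" "k c"] k kE that by (simp add: line_graph_def)
  qed
  then show False
    using Q(3) by simp
qed

theorem theorem1p1:
  fixes \<Gamma> :: "'a sgraph"
  assumes "simple_graph \<Gamma>" and "connected_graph \<Gamma>"
  shows "is_line_graph_of_multigraph \<Gamma> \<longleftrightarrow>
    \<not> (\<exists>W H. W \<subseteq> verts \<Gamma> \<and> H \<in> class_E6 \<and> graph_iso (induced_subgraph \<Gamma> W) H)"
  using line_graph_if_E6_free[OF assms(1)] E6_free_if_line_graph by blast

end
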